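(* Let $G$ be a finite simple graph with adjacency matrix $A$, chromatic number $\chi(G)$, and inertia $(n^+, n^0, n^-)$. Then \[ 1 + \max\left(\frac{n^+}{n^-} , \frac{n^-}{n^+}\right) \le \chi(G). \]
   Context: The inertia of $G$ is the ordered triple $(n^+, n^0, n^-)$, where $n^+$, $n^0$, $n^-$ are the numbers of positive, zero and negative eigenvalues of the adjacency matrix $A$, counted with multiplicity. The paper assumes throughout that $G$ has $n \ge 2$ vertices. *)

theory Defs
  imports
    "Graph_Theory.Pair_Digraph"
    "Jordan_Normal_Form.Char_Poly"
begin

text \<open>
  A finite simple graph is a \<^locale>\<open>pair_graph\<close>: a finite, symmetric, loop-free set of vertex
  pairs, so that each undirected edge is represented by both of its orientations.
\<close>

definition proper_colouring :: "'a pair_pre_digraph \<Rightarrow> nat \<Rightarrow> ('a \<Rightarrow> nat) \<Rightarrow> bool" where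
  "proper_colouring G k c \<longleftrightarrow>
     (\<forall>v \<in> pverts G. c v < k) \<and> (\<forall>(u, v) \<in> parcs G. c u \<noteq> c v)"

definition chromatic_number :: "'a pair_pre_digraph \<Rightarrow> nat" where
  "chromatic_number G = (LEAST k. \<exists>c. proper_colouring G k c)"

text \<open>Rows and columns are indexed along \<open>vs\<close>, meant to list every vertex exactly once.\<close>

definition adjacency_matrix :: "'a pair_pre_digraph \<Rightarrow> 'a list \<Rightarrow> real mat" where
  "adjacency_matrix G vs =
     mat (length vs) (length vs) (\<lambda>(i, j). if (vs ! i, vs ! j) \<in> parcs G then 1 else 0)"

definition count_eigenvalues :: "real mat \<Rightarrow> (real \<Rightarrow> bool) \<Rightarrow> nat" where
  "count_eigenvalues A P = (\<Sum>x | eigenvalue A x \<and> P x. order x (char_poly A))"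

text \<open>
  Only real eigenvalues are counted; for the symmetric matrices considered here these are all of
  them, and their algebraic and geometric multiplicities agree.
\<close>

definition inertia :: "real mat \<Rightarrow> nat \<times> nat \<times> nat" where
  "inertia A =
     (count_eigenvalues A (\<lambda>x. x > 0),
      count_eigenvalues A (\<lambda>x. x = 0),
      count_eigenvalues A (\<lambda>x. x < 0))"

end

theory Submission
  imports Defs "Jordan_Normal_Form.Schur_Decomposition"
begin

text \<open>
  Let \<open>q\<close> be the quadratic form of \<open>A\<close> and let \<open>c\<close> be a proper colouring with \<open>m + 1\<close> colours.
  Assign to the colours vectors in \<open>m\<close>-space with pairwise inner products \<open>-1\<close>, and let \<open>T\<^sub>l\<close>
  scale each coordinate of a vector \<open>x\<close> by the \<open>l\<close>-th coordinate of the vector of its colour.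
  As \<open>A\<close> vanishes within colour classes, the sum of the \<open>q (T\<^sub>l x)\<close> over \<open>l < m\<close> is \<open>- q x\<close>.
  If \<open>n\<^sup>+ > m n\<^sup>-\<close>, then some nonzero \<open>x\<close> in the span of the positive eigenvectors
  has all \<open>T\<^sub>l x\<close> orthogonal to the negative eigenvectors, so that \<open>q x > 0\<close> while every
  \<open>q (T\<^sub>l x) \<ge> 0\<close>, a contradiction. Applying this to \<open>- A\<close> as well gives both bounds.
\<close>

section \<open>Orthogonal diagonalization of real symmetric matrices\<close>

text \<open>The fundamental theorem of algebra yields a complex root of the characteristic
  polynomial; symmetry forces it to be real, because the Hermitian form of \<open>A\<close> takes
  only real values.\<close>

lemma symmetric_real_mat_eigenvalue:
  fixes A :: "real mat"
  assumes A: "A \<in> carrier_mat n n" and sym: "transpose_mat A = A" and n: "n > 0"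
  obtains e where "eigenvalue A e"
proof -
  let ?h = "complex_of_real"
  let ?C = "map_mat ?h A"
  have C: "?C \<in> carrier_mat n n" using A by simp
  have "\<not> constant (poly (char_poly ?C))"
    using degree_monic_char_poly[OF C] n by (simp add: constant_degree)
  then obtain z where "poly (char_poly ?C) z = 0"
    using fundamental_theorem_of_algebra by blast
  then have "eigenvalue ?C z" using eigenvalue_root_char_poly[OF C] by simp
  then obtain v where v: "v \<in> carrier_vec n" and v0: "v \<noteq> 0\<^sub>v n" and ev: "?C *\<^sub>v v = z \<cdot>\<^sub>v v"
    using C unfolding eigenvalue_def eigenvector_def by auto
  \<comment> \<open>\<open>N\<close> is the squared norm of \<open>v\<close> and \<open>q\<close>
    the Hermitian form of \<open>A\<close> at \<open>v\<close>. The eigenvector equation gives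
    \<open>q = z * N\<close>, so \<open>z\<close> is real because \<open>q\<close> and
    \<open>N\<close> are real and \<open>N \<noteq> 0\<close>.\<close>
  define N where "N = (\<Sum>i<n. v $ i * cnj (v $ i))"
  define q where "q = (\<Sum>i<n. \<Sum>j<n. ?h (A $$ (i, j)) * (v $ j * cnj (v $ i)))"
  have row: "(\<Sum>j<n. ?h (A $$ (i, j)) * v $ j) = z * v $ i" if "i < n" for i
    using arg_cong[OF ev, of "\<lambda>w. w $ i"] that A v
    by (simp add: scalar_prod_def lessThan_atLeast0)
  have "q = (\<Sum>i<n. (\<Sum>j<n. ?h (A $$ (i, j)) * v $ j) * cnj (v $ i))"
    unfolding q_def by (simp add: sum_distrib_right mult.assoc)
  also have "\<dots> = z * N"
    unfolding N_def sum_distrib_left by (intro sum.cong) (auto simp: row mult.assoc)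
  finally have qz: "q = z * N" .
  have symi: "A $$ (i, j) = A $$ (j, i)" if "i < n" "j < n" for i j
    using arg_cong[OF sym, of "\<lambda>M. M $$ (i, j)"] that A by simp
  \<comment> \<open>Conjugation exchanges the roles of the two indices; symmetry of \<open>A\<close>
    undoes the exchange.\<close>
  have "cnj q = (\<Sum>i<n. \<Sum>j<n. ?h (A $$ (i, j)) * (cnj (v $ j) * v $ i))"
    unfolding q_def by simp
  also have "\<dots> = (\<Sum>j<n. \<Sum>i<n. ?h (A $$ (i, j)) * (cnj (v $ j) * v $ i))"
    by (rule sum.swap)
  also have "\<dots> = q"
    unfolding q_def by (intro sum.cong refl) (auto simp: symi mult.commute)
  finally have cq: "cnj q = q" .
  have N: "N = ?h (\<Sum>i<n. (cmod (v $ i))\<^sup>2)"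
    unfolding N_def of_real_sum by (simp add: complex_norm_square del: of_real_power)
  have N0: "N \<noteq> 0"
  proof
    assume "N = 0"
    then have "(\<Sum>i<n. (cmod (v $ i))\<^sup>2) = 0" unfolding N using of_real_eq_0_iff by blast
    then have "\<forall>i<n. v $ i = 0" by (subst (asm) sum_nonneg_eq_0_iff) auto
    then have "v = 0\<^sub>v n" using v by (intro eq_vecI) auto
    with v0 show False ..
  qed
  have "cnj z * N = z * N" using cq unfolding qz by (simp add: N)
  with N0 have "cnj z = z" by simp
  then have z: "z = ?h (Re z)" by (simp add: complex_eq_iff)
  have "poly (map_poly ?h (char_poly A)) (?h (Re z)) = 0"
    using \<open>poly (char_poly ?C) z = 0\<close> z of_real_hom.char_poly_hom[OF A] by metis
  then have "poly (char_poly A) (Re z) = 0" by simp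
  then show thesis using that eigenvalue_root_char_poly[OF A] by blast
qed

text \<open>Gram-Schmidt applied to a basis that starts with \<open>v\<close> keeps \<open>v\<close>
  in front, and normalizing only rescales it by \<open>c\<close>. This serves to split off one
  eigenvector at a time.\<close>

lemma orthogonal_mat_with_first_col:
  fixes v :: "real vec"
  assumes v: "v \<in> carrier_vec n" and v0: "v \<noteq> 0\<^sub>v n"
  obtains W c where "W \<in> carrier_mat n n" "transpose_mat W * W = 1\<^sub>m n" "col W 0 = c \<cdot>\<^sub>v v"
proof -
  interpret cof_vec_space n "TYPE(real)" .
  define b where "b = basis_completion v"
  define ws where "ws = gram_schmidt n b"
  note bc = basis_completion[OF v v0, folded b_def]
  have n: "n > 0" using v v0 by (cases n) (auto intro: eq_vecI)
  obtain vs where bv: "b = v # vs" using bc(6,7) n by (cases b) auto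
  note gs = gram_schmidt_result[OF bc(2) bc(4) bc(5) ws_def]
  have len: "length ws = n" using gs(4) bc(6) by simp
  have hdws: "ws ! 0 = v" using gram_schmidt_hd[OF v, of vs] len n
    unfolding ws_def bv by (simp add: hd_conv_nth flip: length_greater_0_conv)
  \<comment> \<open>Conjugation is trivial over the reals. The equivalence at \<open>i = j\<close>
    also says that no \<open>ws ! i\<close> has norm zero, which permits normalization.\<close>
  have orth: "ws ! i \<bullet> ws ! j = 0 \<longleftrightarrow> i \<noteq> j" if "i < n" "j < n" for i j
  proof -
    have "conjugate (ws ! j) = ws ! j" by (intro eq_vecI) auto
    then show ?thesis using corthogonalD[OF gs(2), of i j] that len by simp
  qed
  have wsc: "ws ! i \<in> carrier_vec n" if "i < n" for i using gs(3) len that by auto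
  define us where "us = map (\<lambda>w. (1 / sqrt (w \<bullet> w)) \<cdot>\<^sub>v w) ws"
  define W where "W = mat_of_cols n us"
  have W: "W \<in> carrier_mat n n" unfolding W_def us_def using len by auto
  have colW: "col W i = (1 / sqrt (ws ! i \<bullet> ws ! i)) \<cdot>\<^sub>v ws ! i" if "i < n" for i
    using that len wsc[OF that] unfolding W_def us_def by simp
  have "transpose_mat W * W = 1\<^sub>m n"
  proof (rule eq_matI)
    fix i j assume "i < dim_row (1\<^sub>m n :: real mat)" "j < dim_col (1\<^sub>m n :: real mat)"
    then have i: "i < n" and j: "j < n" by auto
    have "ws ! i \<bullet> ws ! i \<ge> 0" by (simp add: scalar_prod_def sum_nonneg)
    then have "ws ! i \<bullet> ws ! i > 0" using orth[OF i i] by simp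
    then show "(transpose_mat W * W) $$ (i, j) = 1\<^sub>m n $$ (i, j)"
      using i j W wsc[OF i] wsc[OF j] orth[OF i j] by (auto simp: colW)
  qed (use W in auto)
  then show thesis using that W colW[OF n] hdws by metis
qed

text \<open>Deflation: conjugation by an orthogonal matrix whose first column is an eigenvector
  splits off a 1 by 1 block, and the remaining block is again symmetric, so induction on the
  dimension applies.\<close>

lemma symmetric_real_mat_diagonalization:
  fixes A :: "real mat"
  assumes "A \<in> carrier_mat n n" "transpose_mat A = A"
  shows "\<exists>P D. P \<in> carrier_mat n n \<and> D \<in> carrier_mat n n \<and> transpose_mat P * P = 1\<^sub>m n
    \<and> diagonal_mat D \<and> A = P * D * transpose_mat P"
  using assms
proof (induction n arbitrary: A)
  case 0
  then show ?case by (intro exI[of _ "1\<^sub>m 0"]) (auto simp: diagonal_mat_def)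
next
  case (Suc n)
  let ?n = "Suc n"
  note A = Suc.prems(1) and sym = Suc.prems(2)
  obtain e where "eigenvalue A e"
    using symmetric_real_mat_eigenvalue[OF A sym] by auto
  then obtain v where v: "v \<in> carrier_vec ?n" and v0: "v \<noteq> 0\<^sub>v ?n" and ev: "A *\<^sub>v v = e \<cdot>\<^sub>v v"
    using A unfolding eigenvalue_def eigenvector_def by auto
  obtain W c where W: "W \<in> carrier_mat ?n ?n" and WW: "transpose_mat W * W = 1\<^sub>m ?n"
    and col0: "col W 0 = c \<cdot>\<^sub>v v"
    using orthogonal_mat_with_first_col[OF v v0] by blast
  let ?W = "transpose_mat W"
  have Wt: "?W \<in> carrier_mat ?n ?n" using W by simp
  have WW': "W * ?W = 1\<^sub>m ?n" using mat_mult_left_right_inverse[OF Wt W WW] .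
  define B where "B = ?W * (A * W)"
  have B: "B \<in> carrier_mat ?n ?n" unfolding B_def using A W by simp
  have Bsym: "transpose_mat B = B"
    unfolding B_def using A W Wt sym
    by (simp add: transpose_mult[of _ ?n ?n _ ?n] assoc_mult_mat[of _ ?n ?n _ ?n _ ?n])
  \<comment> \<open>The first column of \<open>W\<close> is an eigenvector, and \<open>?W\<close>
    sends it to the first unit vector; hence the first column of \<open>B\<close> is
    \<open>e\<close> times that unit vector.\<close>
  have "A *\<^sub>v col W 0 = e \<cdot>\<^sub>v col W 0"
    unfolding col0 using A v ev by (simp add: mult_mat_vec smult_smult_assoc mult.commute)
  moreover have "col B 0 = ?W *\<^sub>v (A *\<^sub>v col W 0)"
    unfolding B_def using col_mult2[OF Wt, of "A * W" ?n 0] col_mult2[OF A W, of 0] A W by simp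
  ultimately have "col B 0 = e \<cdot>\<^sub>v (?W *\<^sub>v col W 0)"
    using mult_mat_vec[OF Wt, of "col W 0" e] col_dim[of W 0] W by auto
  also have "?W *\<^sub>v col W 0 = col (1\<^sub>m ?n) 0"
    using col_mult2[OF Wt W, of 0] unfolding WW by simp
  finally have colB: "col B 0 = e \<cdot>\<^sub>v unit_vec ?n 0" by simp
  have Bi0: "B $$ (i, 0) = (if i = 0 then e else 0)" if "i < ?n" for i
    using arg_cong[OF colB, of "\<lambda>w. w $ i"] that B by auto
  \<comment> \<open>Symmetry carries the zeros of the first column over to the first row.\<close>
  have B0i: "B $$ (0, i) = (if i = 0 then e else 0)" if "i < ?n" for i
    using arg_cong[OF Bsym, of "\<lambda>M. M $$ (0, i)"] Bi0[OF that] that B by auto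
  define E where "E = mat 1 1 (\<lambda>_. e)"
  define B' where "B' = mat n n (\<lambda>(i, j). B $$ (Suc i, Suc j))"
  have B': "B' \<in> carrier_mat n n" and E: "E \<in> carrier_mat 1 1" unfolding B'_def E_def by auto
  have Bblock: "B = four_block_mat E (0\<^sub>m 1 n) (0\<^sub>m n 1) B'"
    by (rule eq_matI) (use B in \<open>auto simp: E_def B'_def Bi0 B0i\<close>)
  have "transpose_mat B' = B'"
  proof (rule eq_matI)
    fix i j assume "i < dim_row B'" "j < dim_col B'"
    then show "transpose_mat B' $$ (i, j) = B' $$ (i, j)"
      using arg_cong[OF Bsym, of "\<lambda>M. M $$ (Suc i, Suc j)"] B by (auto simp: B'_def)
  qed (auto simp: B'_def)
  from Suc.IH[OF B' this] obtain P' D' where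
    P': "P' \<in> carrier_mat n n" and D': "D' \<in> carrier_mat n n"
    and PP': "transpose_mat P' * P' = 1\<^sub>m n" and diag': "diagonal_mat D'"
    and B'eq: "B' = P' * D' * transpose_mat P'" by auto
  \<comment> \<open>\<open>R\<close> fixes the split-off coordinate and diagonalizes the other
    block; \<open>W * R\<close> is then the diagonalizing matrix of \<open>A\<close>.\<close>
  define R where "R = four_block_mat (1\<^sub>m 1) (0\<^sub>m 1 n) (0\<^sub>m n 1) P'"
  define D where "D = four_block_mat E (0\<^sub>m 1 n) (0\<^sub>m n 1) D'"
  have R: "R \<in> carrier_mat ?n ?n" and D: "D \<in> carrier_mat ?n ?n"
    unfolding R_def D_def using P' D' E by (auto simp: four_block_carrier_mat)
  have Rt: "transpose_mat R = four_block_mat (1\<^sub>m 1) (0\<^sub>m 1 n) (0\<^sub>m n 1) (transpose_mat P')"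
    unfolding R_def using P' by (subst transpose_four_block_mat) auto
  have Rtc: "transpose_mat R \<in> carrier_mat ?n ?n" using R by simp
  have RR: "transpose_mat R * R = 1\<^sub>m ?n"
    unfolding Rt unfolding R_def using P' PP'
    by (subst mult_four_block_mat[of _ 1 1 _ n _ n _ _ 1 _ n]) auto
  have RD: "R * D = four_block_mat E (0\<^sub>m 1 n) (0\<^sub>m n 1) (P' * D')"
    unfolding R_def D_def using P' D' E
    by (subst mult_four_block_mat[of _ 1 1 _ n _ n _ _ 1 _ n]) auto
  have "R * D * transpose_mat R = B"
    unfolding RD Rt Bblock B'eq using P' D' E
    by (subst mult_four_block_mat[of _ 1 1 _ n _ n _ _ 1 _ n]) auto
  then have Beq: "B = R * D * transpose_mat R" ..
  have diag: "diagonal_mat D"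
    using diag' D' E unfolding diagonal_mat_def D_def by auto
  have "W * B * ?W = (W * ?W) * A * (W * ?W)"
    unfolding B_def using A W Wt by (simp add: assoc_mult_mat[of _ ?n ?n _ ?n _ ?n])
  then have "A = W * B * ?W" unfolding WW' using A by simp
  also have "\<dots> = (W * R) * D * transpose_mat (W * R)"
    unfolding Beq using W Wt R Rtc D
    by (simp add: transpose_mult[of _ ?n ?n _ ?n] assoc_mult_mat[of _ ?n ?n _ ?n _ ?n])
  finally have Aeq: "A = (W * R) * D * transpose_mat (W * R)" .
  have "transpose_mat (W * R) * (W * R) = transpose_mat R * (?W * W) * R"
    using W Wt R Rtc
    by (simp add: transpose_mult[of _ ?n ?n _ ?n] assoc_mult_mat[of _ ?n ?n _ ?n _ ?n])
  then have "transpose_mat (W * R) * (W * R) = 1\<^sub>m ?n" unfolding WW using Rtc RR by simp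
  moreover have "W * R \<in> carrier_mat ?n ?n" using W R by simp
  ultimately show ?case using D diag Aeq by blast
qed


text \<open>With \<open>A = P * D * transpose_mat P\<close>, the \<open>d i\<close> are the diagonal
  entries of \<open>D\<close> and the \<open>p i\<close> the columns of \<open>P\<close>. Similarity
  gives the first clause, invertibility of \<open>transpose_mat P\<close> the third, and the
  coordinates \<open>p i \<bullet> x\<close> diagonalize the form.\<close>

lemma symmetric_real_mat_quadratic_form:
  fixes A :: "real mat"
  assumes A: "A \<in> carrier_mat n n" and sym: "transpose_mat A = A"
  obtains d p where
    "char_poly A = (\<Prod>i<n. [:- d i, 1:])"
    "\<forall>i. p i \<in> carrier_vec n"
    "\<forall>x\<in>carrier_vec n. (\<forall>i<n. p i \<bullet> x = 0) \<longrightarrow> x = 0\<^sub>v n"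
    "\<forall>x\<in>carrier_vec n.
      (\<Sum>i<n. \<Sum>j<n. A $$ (i, j) * (x $ i * x $ j)) = (\<Sum>i<n. d i * (p i \<bullet> x)\<^sup>2)"
proof -
  obtain P D where P: "P \<in> carrier_mat n n" and D: "D \<in> carrier_mat n n"
    and PP: "transpose_mat P * P = 1\<^sub>m n" and diag: "diagonal_mat D"
    and Aeq: "A = P * D * transpose_mat P"
    using symmetric_real_mat_diagonalization[OF A sym] by blast
  have Pt: "transpose_mat P \<in> carrier_mat n n" using P by simp
  note PP' = mat_mult_left_right_inverse[OF Pt P PP]
  have "similar_mat A D"
    unfolding similar_mat_def using similar_mat_witI[OF PP' PP Aeq A D P Pt] by blast
  moreover have "upper_triangular D"
    using diag D unfolding diagonal_mat_def upper_triangular_def by auto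
  ultimately have "char_poly A = (\<Prod>a\<leftarrow>diag_mat D. [:- a, 1:])"
    using char_poly_similar char_poly_upper_triangular[OF D] by metis
  also have "\<dots> = (\<Prod>i<n. [:- (D $$ (i, i)), 1:])"
    using D unfolding diag_mat_def
    using prod.distinct_set_conv_list[of "[0..<n]" "\<lambda>i. [:- (D $$ (i, i)), 1:]"]
    by (simp add: o_def lessThan_atLeast0)
  finally have 1: "char_poly A = (\<Prod>i<n. [:- (D $$ (i, i)), 1:])" .
  have 2: "col P i \<in> carrier_vec n" for i using P col_dim[of P i] by auto
  have y: "transpose_mat P *\<^sub>v x = vec n (\<lambda>i. col P i \<bullet> x)" if "x \<in> carrier_vec n" for x
    using P that by (intro eq_vecI) auto
  have 3: "x = 0\<^sub>v n" if x: "x \<in> carrier_vec n" and z: "\<forall>i<n. col P i \<bullet> x = 0" for x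
  proof -
    have "transpose_mat P *\<^sub>v x = 0\<^sub>v n" using y[OF x] z by auto
    then have "P *\<^sub>v (transpose_mat P *\<^sub>v x) = 0\<^sub>v n" using P by auto
    then show ?thesis using assoc_mult_mat_vec[OF P Pt x] PP' x by simp
  qed
  have 4: "(\<Sum>i<n. \<Sum>j<n. A $$ (i, j) * (x $ i * x $ j)) = (\<Sum>i<n. D $$ (i, i) * (col P i \<bullet> x)\<^sup>2)"
    if x: "x \<in> carrier_vec n" for x
  proof -
    define y where "y = transpose_mat P *\<^sub>v x"
    have yc: "y \<in> carrier_vec n" unfolding y_def using Pt x by simp
    have yi: "y $ i = col P i \<bullet> x" if "i < n" for i
      using y[OF x] that unfolding y_def by simp
    have Dy: "(D *\<^sub>v y) $ i = D $$ (i, i) * y $ i" if "i < n" for i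
    proof -
      have "(D *\<^sub>v y) $ i = (\<Sum>j<n. D $$ (i, j) * y $ j)"
        using D yc that by (simp add: scalar_prod_def lessThan_atLeast0)
      also have "\<dots> = (\<Sum>j<n. if j = i then D $$ (i, i) * y $ i else 0)"
        by (intro sum.cong) (use diag D that in \<open>auto simp: diagonal_mat_def\<close>)
      finally show ?thesis using that by simp
    qed
    have "(\<Sum>i<n. \<Sum>j<n. A $$ (i, j) * (x $ i * x $ j)) = x \<bullet> (A *\<^sub>v x)"
      using A x by (simp add: scalar_prod_def lessThan_atLeast0 sum_distrib_left mult.assoc mult.left_commute)
    also have "A *\<^sub>v x = P *\<^sub>v (D *\<^sub>v y)"
      unfolding Aeq y_def using P D Pt x by (simp add: assoc_mult_mat_vec[of _ n n _ n])
    also have "x \<bullet> (P *\<^sub>v (D *\<^sub>v y)) = y \<bullet> (D *\<^sub>v y)"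
      unfolding y_def using transpose_vec_mult_scalar[OF P _ x] D yc y_def by simp
    also have "\<dots> = (\<Sum>i<n. D $$ (i, i) * (col P i \<bullet> x)\<^sup>2)"
      using D yc Dy yi
      by (simp add: scalar_prod_def[of y] lessThan_atLeast0 power2_eq_square mult.left_commute del: index_mult_mat_vec)
    finally show ?thesis .
  qed
  show thesis using that[OF 1, of "col P"] 2 3 4 by blast
qed

section \<open>Counting eigenvalues with multiplicity\<close>

text \<open>The order of the characteristic polynomial at \<open>x\<close> is the size of the fibre
  of \<open>d\<close> over \<open>x\<close>, and the fibres partition the indices.\<close>

lemma count_eigenvalues_linear_factors:
  assumes A: "A \<in> carrier_mat n n" and cp: "char_poly A = (\<Prod>i<n. [:- d i, 1:])"
  shows "count_eigenvalues A Q = card {i. i < n \<and> Q (d i)}"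
proof -
  have ev: "eigenvalue A x \<longleftrightarrow> x \<in> d ` {..<n}" for x
    unfolding eigenvalue_root_char_poly[OF A] cp by (auto simp: poly_prod)
  have ord: "Polynomial.order x (char_poly A) = card {i. i < n \<and> d i = x}" for x
  proof -
    \<comment> \<open>Generalized to any finite index set for the induction; each factor has order 1
      at its root and 0 elsewhere.\<close>
    have "Polynomial.order x (\<Prod>i\<in>S. [:- d i, 1:]) = card {i\<in>S. d i = x}" if "finite S" for S :: "nat set"
      using that
    proof (induction S rule: finite_induct)
      case (insert a S)
      have "{i \<in> insert a S. d i = x} = (if d a = x then insert a {i\<in>S. d i = x} else {i\<in>S. d i = x})"
        by auto
      moreover have "Polynomial.order x [:- d a, 1:] = (if d a = x then 1 else 0)"
        by (auto simp: order_linear order_0I)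
      moreover have "Polynomial.order x (\<Prod>i\<in>insert a S. [:- d i, 1:])
        = Polynomial.order x [:- d a, 1:] + Polynomial.order x (\<Prod>i\<in>S. [:- d i, 1:])"
        unfolding prod.insert[OF insert.hyps]
        by (rule order_mult) (use insert.hyps in \<open>simp del: mult_pCons_left\<close>)
      ultimately show ?case using insert by auto
    qed simp
    from this[of "{..<n}"] show ?thesis unfolding cp by simp
  qed
  have "count_eigenvalues A Q = (\<Sum>x\<in>{x \<in> d ` {..<n}. Q x}. card {i. i < n \<and> d i = x})"
    unfolding count_eigenvalues_def ev ord by simp
  also have "\<dots> = card (\<Union>x\<in>{x \<in> d ` {..<n}. Q x}. {i. i < n \<and> d i = x})"
    by (rule card_UN_disjoint[symmetric]) auto
  also have "(\<Union>x\<in>{x \<in> d ` {..<n}. Q x}. {i. i < n \<and> d i = x}) = {i. i < n \<and> Q (d i)}"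
    by auto
  finally show ?thesis .
qed

section \<open>Comparing positive and negative eigenvalues through a colouring\<close>

text \<open>Fewer than \<open>n\<close> homogeneous linear equations in \<open>n\<close> unknowns
  have a nontrivial solution: padded with zero rows, they form a singular square matrix.\<close>

lemma exists_nonzero_orthogonal_vec:
  fixes S :: "'a :: field vec set"
  assumes "finite S" "S \<subseteq> carrier_vec n" "card S < n"
  obtains x where "x \<in> carrier_vec n" "x \<noteq> 0\<^sub>v n" "\<And>w. w \<in> S \<Longrightarrow> w \<bullet> x = 0"
proof -
  obtain ws where ws: "set ws = S" "length ws = card S"
    using finite_distinct_list[OF assms(1)] distinct_card by metis
  define r where "r = (\<lambda>i. if i < length ws then ws ! i else 0\<^sub>v n)"
  have r: "r i \<in> carrier_vec n" for i
    using assms(2) ws(1) nth_mem unfolding r_def by (auto simp: subset_iff)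
  \<comment> \<open>Row \<open>length ws\<close> is the first padding row and exists because
    \<open>card S < n\<close>. It is singled out, although \<open>r\<close> is zero there, to fit
    the shape of \<open>det_row_0\<close>.\<close>
  define M where "M = mat\<^sub>r n n (\<lambda>i. if i = length ws then 0\<^sub>v n else r i)"
  have M: "M \<in> carrier_mat n n" unfolding M_def by simp
  have "det M = 0" unfolding M_def by (rule det_row_0) (use assms(3) ws r in auto)
  then obtain x where x: "x \<in> carrier_vec n" "x \<noteq> 0\<^sub>v n" "M *\<^sub>v x = 0\<^sub>v n"
    using det_0_iff_vec_prod_zero_field[OF M] by blast
  have "w \<bullet> x = 0" if w: "w \<in> S" for w
  proof -
    obtain i where i: "i < length ws" "w = ws ! i" using w ws(1) by (metis in_set_conv_nth)
    then have "i < n" using ws(2) assms(3) by linarith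
    then have "row M i = r i" using i(1) r unfolding M_def by simp
    then have "row M i = w" using i unfolding r_def by simp
    then show ?thesis using arg_cong[OF x(3), of "\<lambda>u. u $ i"] \<open>i < n\<close> M by simp
  qed
  then show thesis using that x by blast
qed

text \<open>
  The first \<open>m\<close> coordinates of the \<open>i\<close>-th vertex, \<open>i \<le> m\<close>, of a simplex whose vertices have pairwise
  inner products \<open>-1\<close>. Their norms are irrelevant here, which permits integer coordinates.
\<close>

definition simplex_coord :: "nat \<Rightarrow> nat \<Rightarrow> real" where
  "simplex_coord l i = (if i < l then 0 else if i = l then - real (l + 1) else 1)"

text \<open>Coordinates \<open>l < i\<close> contribute 1 each, \<open>l = i\<close> contributes
  \<open>- (i + 1)\<close>, and later ones vanish. The case \<open>m \<le> i\<close> covers the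
  partial sums met in the induction on \<open>m\<close>.\<close>

lemma sum_simplex_coord_less:
  assumes "i < j"
  shows "(\<Sum>l<m. simplex_coord l i * simplex_coord l j) = (if m \<le> i then real m else - 1)"
  using assms by (induction m) (auto simp: simplex_coord_def)

lemma sum_simplex_coord:
  assumes "i \<noteq> j" "i \<le> m" "j \<le> m"
  shows "(\<Sum>l<m. simplex_coord l i * simplex_coord l j) = - 1"
  using assms sum_simplex_coord_less[of i j m] sum_simplex_coord_less[of j i m]
  by (cases "i < j") (auto simp: mult.commute)

text \<open>Stated for abstract coefficients \<open>a\<close> and \<open>d\<close>, so that it
  applies to a matrix and to its negative alike. The colours are \<open>0\<close> to
  \<open>m\<close>, hence \<open>m + 1\<close> in number.\<close>

lemma positive_le_mult_negative:
  fixes a :: "nat \<Rightarrow> nat \<Rightarrow> real"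
  assumes p: "\<And>i. p i \<in> carrier_vec n"
    and nondeg: "\<And>x. x \<in> carrier_vec n \<Longrightarrow> \<forall>i<n. p i \<bullet> x = 0 \<Longrightarrow> x = 0\<^sub>v n"
    and q: "\<And>x. x \<in> carrier_vec n \<Longrightarrow>
      (\<Sum>i<n. \<Sum>j<n. a i j * (x $ i * x $ j)) = (\<Sum>i<n. d i * (p i \<bullet> x)\<^sup>2)"
    and col: "\<And>i j. i < n \<Longrightarrow> j < n \<Longrightarrow> a i j \<noteq> 0 \<Longrightarrow> c i \<noteq> c j"
    and le: "\<And>i. i < n \<Longrightarrow> c i \<le> m"
  shows "card {i. i < n \<and> d i > 0} \<le> m * card {i. i < n \<and> d i < 0}"
proof (rule ccontr)
  assume less: "\<not> ?thesis"
  let ?pos = "{i. i < n \<and> d i > 0}" and ?neg = "{i. i < n \<and> d i < 0}"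
  define T :: "nat \<Rightarrow> real vec \<Rightarrow> real vec"
    where "T l x = vec n (\<lambda>i. simplex_coord l (c i) * x $ i)" for l x
  have T: "T l x \<in> carrier_vec n" for l x unfolding T_def by simp
  have Tadj: "T l w \<bullet> x = w \<bullet> T l x" if "w \<in> carrier_vec n" "x \<in> carrier_vec n" for l w x
    using that by (simp add: T_def scalar_prod_def mult_ac)
  \<comment> \<open>Orthogonality to \<open>S1\<close> removes every term with
    \<open>d i \<le> 0\<close> from the form at \<open>x\<close>.\<close>
  define S1 where "S1 = p ` ({..<n} - ?pos)"
  \<comment> \<open>As \<open>T l\<close> is self-adjoint, orthogonality of \<open>x\<close> to
    \<open>S2\<close> makes each \<open>T l x\<close> orthogonal to the \<open>p i\<close> with
    \<open>d i < 0\<close>.\<close>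
  define S2 where "S2 = (\<lambda>(l, i). T l (p i)) ` ({..<m} \<times> ?neg)"
  have "card S1 \<le> n - card ?pos"
    unfolding S1_def by (rule order_trans[OF card_image_le]) (auto simp: card_Diff_subset Collect_mono_iff subset_iff)
  moreover have "card S2 \<le> m * card ?neg"
    unfolding S2_def by (rule order_trans[OF card_image_le]) auto
  moreover have "card ?pos \<le> n" using card_mono[of "{..<n}" ?pos] by auto
  ultimately have "card (S1 \<union> S2) < n" using less card_Un_le[of S1 S2] by linarith
  moreover have "finite (S1 \<union> S2)" "S1 \<union> S2 \<subseteq> carrier_vec n"
    unfolding S1_def S2_def using p T by auto
  ultimately obtain x where x: "x \<in> carrier_vec n" "x \<noteq> 0\<^sub>v n"
    and orth: "\<And>w. w \<in> S1 \<union> S2 \<Longrightarrow> w \<bullet> x = 0"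
    using exists_nonzero_orthogonal_vec by blast
  let ?q = "\<lambda>x. \<Sum>i<n. \<Sum>j<n. a i j * (x $ i * x $ j)"
  have zero: "p i \<bullet> x = 0" if "i < n" "\<not> d i > 0" for i
    using orth[of "p i"] that unfolding S1_def by auto
  \<comment> \<open>By \<open>zero\<close>, this index has \<open>d i0 > 0\<close> and so
    contributes a strictly positive term.\<close>
  obtain i0 where i0: "i0 < n" "p i0 \<bullet> x \<noteq> 0" using nondeg x by blast
  have "?q x > 0" unfolding q[OF x(1)]
  proof (rule sum_pos2[of _ i0])
    show "0 < d i0 * (p i0 \<bullet> x)\<^sup>2" using zero i0 by (cases "d i0 > 0") auto
    show "0 \<le> d i * (p i \<bullet> x)\<^sup>2" if "i \<in> {..<n}" for i
      using zero[of i] that by (cases "d i > 0") auto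
  qed (use i0 in auto)
  moreover have "?q (T l x) \<ge> 0" if "l < m" for l unfolding q[OF T]
  proof (rule sum_nonneg)
    fix i assume i: "i \<in> {..<n}"
    show "0 \<le> d i * (p i \<bullet> T l x)\<^sup>2"
    proof (cases "d i < 0")
      case True
      then have "T l (p i) \<bullet> x = 0" using orth that i unfolding S2_def by force
      then show ?thesis using Tadj p x by simp
    qed auto
  qed
  then have "(\<Sum>l<m. ?q (T l x)) \<ge> 0" by (rule sum_nonneg) simp
  moreover have "(\<Sum>l<m. ?q (T l x)) = - ?q x"
  proof -
    have "(\<Sum>l<m. ?q (T l x)) = (\<Sum>i<n. \<Sum>j<n. \<Sum>l<m. a i j * (T l x $ i * T l x $ j))"
      by (subst sum.swap) (intro sum.cong refl sum.swap)
    also have "\<dots> = (\<Sum>i<n. \<Sum>j<n. - (a i j * (x $ i * x $ j)))"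
    proof (intro sum.cong refl)
      fix i j assume ij: "i \<in> {..<n}" "j \<in> {..<n}"
      have "(\<Sum>l<m. a i j * (T l x $ i * T l x $ j))
        = a i j * (x $ i * x $ j) * (\<Sum>l<m. simplex_coord l (c i) * simplex_coord l (c j))"
        unfolding sum_distrib_left using ij by (intro sum.cong) (auto simp: T_def mult_ac)
      \<comment> \<open>If \<open>a i j\<close> is nonzero, the colours differ and the simplex sum
        is \<open>- 1\<close>; otherwise both sides are zero.\<close>
      then show "(\<Sum>l<m. a i j * (T l x $ i * T l x $ j)) = - (a i j * (x $ i * x $ j))"
        using ij sum_simplex_coord[OF col] le by (cases "a i j = 0") auto
    qed
    finally show ?thesis by (simp add: sum_negf)
  qed
  ultimately show False by simp
qed

section \<open>Colourings and the final bound\<close>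

text \<open>The least \<open>k\<close> is attained because some colouring exists: an injective
  numbering of the finitely many vertices is proper in the absence of loops.\<close>

lemma chromatic_number_colouring:
  assumes "finite (pverts G)" "\<And>u v. (u, v) \<in> parcs G \<Longrightarrow> u \<in> pverts G \<and> v \<in> pverts G \<and> u \<noteq> v"
  obtains c where "proper_colouring G (chromatic_number G) c"
proof -
  obtain f and k :: nat where "f ` pverts G = {i. i < k}" "inj_on f (pverts G)"
    using finite_imp_inj_to_nat_seg[OF assms(1)] by metis
  then have "proper_colouring G k f"
    unfolding proper_colouring_def using assms(2) by (force dest: inj_onD)
  then have "\<exists>k c. proper_colouring G k c" by blast
  from LeastI_ex[OF this] show thesis using that unfolding chromatic_number_def by blast
qed

theorem theorem1:
  fixes G :: "'a pair_pre_digraph" and vs :: "'a list" and A :: "real mat"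
    and n_pos n_zero n_neg :: nat
  assumes "pair_graph G"
    and "card (pverts G) \<ge> 2"
    and "distinct vs" and "set vs = pverts G"
    and "A = adjacency_matrix G vs"
    and "inertia A = (n_pos, n_zero, n_neg)"
  shows "1 + max (real n_pos / real n_neg) (real n_neg / real n_pos) \<le> real (chromatic_number G)"
proof -
  interpret pair_graph G by fact
  define n where "n = length vs"
  have n: "n \<ge> 2" using assms(2,3,4) distinct_card unfolding n_def by metis
  have A: "A \<in> carrier_mat n n" unfolding assms(5) adjacency_matrix_def n_def by simp
  have arcs_sym: "(u, v) \<in> parcs G \<longleftrightarrow> (v, u) \<in> parcs G" for u v
    using arcs_symmetric by blast
  have sym: "transpose_mat A = A"
    unfolding assms(5) adjacency_matrix_def using arcs_sym by (intro eq_matI) auto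
  have entry: "(vs ! i, vs ! j) \<in> parcs G" if "i < n" "j < n" "A $$ (i, j) \<noteq> 0" for i j
    using that unfolding assms(5) adjacency_matrix_def n_def by (auto split: if_splits)
  obtain c where c: "proper_colouring G (chromatic_number G) c"
    using chromatic_number_colouring[OF pair_finite_verts] no_loops in_arcsD1 in_arcsD2
    by (metis fst_conv snd_conv)
  define m where "m = chromatic_number G - 1"
  have c_less: "c (vs ! i) < chromatic_number G" if "i < n" for i
    using c assms(4) that unfolding proper_colouring_def n_def by auto
  \<comment> \<open>The vertex at index 0 has a colour, so the chromatic number is positive and the
    truncated subtraction in \<open>m\<close> is exact.\<close>
  have chi: "chromatic_number G = m + 1" using c_less[of 0] n unfolding m_def by simp
  have c_le: "c (vs ! i) \<le> m" if "i < n" for i using c_less[OF that] chi by simp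
  have c_neq: "c (vs ! i) \<noteq> c (vs ! j)" if "i < n" "j < n" "A $$ (i, j) \<noteq> 0" for i j
    using c entry[OF that] unfolding proper_colouring_def by auto
  obtain p d where cp: "char_poly A = (\<Prod>i<n. [:- d i, 1:])"
    and p: "\<forall>i. p i \<in> carrier_vec n"
    and nondeg: "\<forall>x\<in>carrier_vec n. (\<forall>i<n. p i \<bullet> x = 0) \<longrightarrow> x = 0\<^sub>v n"
    and q: "\<forall>x\<in>carrier_vec n.
      (\<Sum>i<n. \<Sum>j<n. A $$ (i, j) * (x $ i * x $ j)) = (\<Sum>i<n. d i * (p i \<bullet> x)\<^sup>2)"
    by (rule symmetric_real_mat_quadratic_form[OF A sym]) (rule that)
  have pos: "n_pos = card {i. i < n \<and> d i > 0}" and neg: "n_neg = card {i. i < n \<and> d i < 0}"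
    using assms(6) count_eigenvalues_linear_factors[OF A cp] unfolding inertia_def by auto
  have nondeg': "x = 0\<^sub>v n" if "x \<in> carrier_vec n" "\<forall>i<n. p i \<bullet> x = 0" for x
    using nondeg that by blast
  have "n_pos \<le> m * n_neg"
    unfolding pos neg using spec[OF p] nondeg' bspec[OF q] c_neq c_le
    by (rule positive_le_mult_negative)
  moreover have "n_neg \<le> m * n_pos"
  proof -
    \<comment> \<open>Negating \<open>A\<close> negates every \<open>d i\<close>, which swaps the
      two counts.\<close>
    have q': "(\<Sum>i<n. \<Sum>j<n. - A $$ (i, j) * (x $ i * x $ j)) = (\<Sum>i<n. - d i * (p i \<bullet> x)\<^sup>2)"
      if "x \<in> carrier_vec n" for x
      using bspec[OF q that] by (simp add: sum_negf)
    have c_neq': "c (vs ! i) \<noteq> c (vs ! j)" if "i < n" "j < n" "- A $$ (i, j) \<noteq> 0" for i j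
      using c_neq that by simp
    have "card {i. i < n \<and> - d i > 0} \<le> m * card {i. i < n \<and> - d i < 0}"
      using spec[OF p] nondeg' q' c_neq' c_le by (rule positive_le_mult_negative)
    then show ?thesis unfolding pos neg by simp
  qed
  \<comment> \<open>Division by zero yields 0, so the bound also holds for \<open>b = 0\<close>; in
    an edgeless graph both quotients are 0.\<close>
  moreover have "real a / real b \<le> real m" if "a \<le> m * b" for a b
  proof (cases "b = 0")
    case False
    have "real a \<le> real m * real b" using that by (metis of_nat_le_iff of_nat_mult)
    then show ?thesis using False by (simp add: divide_le_eq)
  qed simp
  ultimately show ?thesis unfolding chi by simp
qed

end
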